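(* Let $(M,g)$ be an $n$-dimensional $(N(k),\xi)$-semi-Riemannian manifold, let $a_0,\dots,a_7,b_0,\dots,b_7$ be real numbers, and suppose $M$ is $(\mathcal{T}_a,S_{\mathcal{T}_b})$-pseudosymmetric, i.e. $\mathcal{T}_a\cdot S_{\mathcal{T}_b}=L\,Q(g,S_{\mathcal{T}_b})$ for a smooth function $L$ on $M$. Then for all vector fields $Y,U$: \begin{align*} &\varepsilon a_5(b_0+nb_1+b_2+b_3+b_5+b_6)S^2(Y,U)\\ &+\big\{\varepsilon(b_0+nb_1+b_2+b_3+b_5+b_6)(-ka_0+k(n-1)a_1+k(n-1)a_2-a_7r)\\ &\qquad+\varepsilon(a_1+a_5)(b_4r+(n-1)b_7r)\big\}S(Y,U)\\ &+\big\{\varepsilon k(n-1)(a_2+a_4)(b_4r+(n-1)b_7r)\\ &\qquad+\varepsilon k(n-1)(b_0+nb_1+b_2+b_3+b_5+b_6)(ka_0+k(n-1)a_4+a_7r)\big\}g(Y,U)\\ &+k(n-1)(a_1+a_2+2a_3+a_4+a_5+2a_6)\big\{b_4r+(n-1)b_7r\\ &\qquad+k(n-1)(b_0+nb_1+b_2+b_3+b_5+b_6)\big\}\eta(Y)\eta(U)\\ =\;&L(b_0+nb_1+b_2+b_3+b_5+b_6)\big(\varepsilon k(n-1)g(Y,U)-\varepsilon S(Y,U)\big). \end{align*} In particular, if $M$ is $(\mathcal{T}_a,S_{\mathcal{T}_a})$-pseudosymmetric, i.e. $\mathcal{T}_a\cdot S_{\mathcal{T}_a}=L\,Q(g,S_{\mathcal{T}_a})$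 for a smooth function $L$ on $M$, then \begin{align*} &\varepsilon a_5(a_0+na_1+a_2+a_3+a_5+a_6)S^2(Y,U)\\ &+\big\{\varepsilon(a_0+na_1+a_2+a_3+a_5+a_6)(-ka_0+k(n-1)a_1+k(n-1)a_2-a_7r)\\ &\qquad+\varepsilon(a_1+a_5)(a_4r+(n-1)a_7r)\big\}S(Y,U)\\ &+\big\{\varepsilon k(n-1)(a_2+a_4)(a_4r+(n-1)a_7r)\\ &\qquad+\varepsilon k(n-1)(a_0+na_1+a_2+a_3+a_5+a_6)(ka_0+k(n-1)a_4+a_7r)\big\}g(Y,U)\\ &+k(n-1)(a_1+a_2+2a_3+a_4+a_5+2a_6)\big\{a_4r+(n-1)a_7r\\ &\qquad+k(n-1)(a_0+na_1+a_2+a_3+a_5+a_6)\big\}\eta(Y)\eta(U)\\ =\;&L(a_0+na_1+a_2+a_3+a_5+a_6)\big(\varepsilon k(n-1)g(Y,U)-\varepsilon S(Y,U)\big). \end{align*}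
   Context: $(M,g)$ is an $n$-dimensional semi-Riemannian manifold; $R$ is its curvature tensor (sign convention: constant curvature $c$ means $R(X,Y)Z=c(g(Y,Z)X-g(X,Z)Y)$), $S(Y,Z)=\mathrm{tr}(X\mapsto R(X,Y)Z)$ the Ricci tensor, $Q$ the Ricci operator ($g(QX,Y)=S(X,Y)$), $r$ the scalar curvature, $S^2(X,Y)=S(QX,Y)$. $(N(k),\xi)$-semi-Riemannian manifold: $k$ is a real number and $\xi$ is a vector field with $g(\xi,\xi)=\varepsilon\in\{1,-1\}$ lying in the $k$-nullity distribution, i.e. $R(X,Y)\xi=k(g(Y,\xi)X-g(X,\xi)Y)$ for all $X,Y$; $\eta(X)=\varepsilon g(X,\xi)$. For real $a_0,\dots,a_7$, the $\mathcal{T}_a$-curvature tensor is $\mathcal{T}_a(X,Y)Z=a_0R(X,Y)Z+a_1S(Y,Z)X+a_2S(X,Z)Y+a_3S(X,Y)Z+a_4g(Y,Z)QX+a_5g(X,Z)QY+a_6g(X,Y)QZ+a_7r(g(Y,Z)X-g(X,Z)Y)$; $\mathcal{T}_b$ is the same with $b_i$ in place of $a_i$. $S_{\mathcal{T}_a}$ is the Ricci-type contraction $S_{\mathcal{T}_a}(Y,Z)=\mathrm{tr}(X\mapsto\mathcal{T}_a(X,Y)Z)$, i.e. $S_{\mathcal{T}_a}=(a_0+na_1+a_2+a_3+a_5+a_6)S+(a_4+(n-1)a_7)r\,g$; likewise $S_{\mathcal{T}_b}$. For a $(0,2)$ tensor $K$ and endomorphism $F$, $(F\cdot K)(U,V)=-K(FU,V)-K(U,FV)$.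 $(\mathcal{T}_a\cdot K)(U,V;X,Y)=(\mathcal{T}_a(X,Y)\cdot K)(U,V)$, and $Q(g,K)(U,V;X,Y)=((X\wedge_g Y)\cdot K)(U,V)$ with $(X\wedge_g Y)Z=g(Y,Z)X-g(X,Z)Y$. *)

theory Defs
  imports "HOL-Analysis.Analysis"
begin

section \<open>Smooth manifolds, given by an atlas\<close>

text \<open>A function is \<open>C\<^sup>k\<close> on an open set if it is differentiable there and all its directional
  derivatives are \<open>C\<^sup>k\<^sup>-\<^sup>1\<close>. The definition is only meant for open \<open>S\<close>.\<close>

primrec Ck_on :: "nat \<Rightarrow> 'a::real_normed_vector set \<Rightarrow> ('a \<Rightarrow> 'b::real_normed_vector) \<Rightarrow> bool" where
  "Ck_on 0 S f \<longleftrightarrow> continuous_on S f"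
| "Ck_on (Suc k) S f \<longleftrightarrow>
     (\<forall>x\<in>S. f differentiable (at x)) \<and> (\<forall>v. Ck_on k S (\<lambda>x. frechet_derivative f (at x) v))"

definition smooth_on :: "'a::real_normed_vector set \<Rightarrow> ('a \<Rightarrow> 'b::real_normed_vector) \<Rightarrow> bool" where
  "smooth_on S f \<longleftrightarrow> (\<forall>k. Ck_on k S f)"

text \<open>A chart is a pair \<open>(U, \<phi>)\<close>; the values of \<open>\<phi>\<close> outside \<open>U\<close> are irrelevant.\<close>

type_synonym ('m, 'n) chart = "'m set \<times> ('m \<Rightarrow> real ^ 'n)"

abbreviation chart_dom :: "('m, 'n) chart \<Rightarrow> 'm set" where
  "chart_dom c \<equiv> fst c"

abbreviation coord :: "('m, 'n) chart \<Rightarrow> 'm \<Rightarrow> real ^ 'n" where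
  "coord c \<equiv> snd c"

definition coord_inv :: "('m, 'n) chart \<Rightarrow> real ^ 'n \<Rightarrow> 'm" where
  "coord_inv c = inv_into (chart_dom c) (coord c)"

definition chart_image :: "('m, 'n) chart \<Rightarrow> (real ^ 'n) set" where
  "chart_image c = coord c ` chart_dom c"

definition is_chart :: "('m::topological_space, 'n::finite) chart \<Rightarrow> bool" where
  "is_chart c \<longleftrightarrow> open (chart_dom c) \<and> open (chart_image c) \<and>
     homeomorphism (chart_dom c) (chart_image c) (coord c) (coord_inv c)"

definition smooth_atlas ::
    "('m::{t2_space, second_countable_topology}, 'n::finite) chart set \<Rightarrow> bool" where
  "smooth_atlas A \<longleftrightarrow> (\<forall>c\<in>A. is_chart c) \<and> (\<Union>c\<in>A. chart_dom c) = UNIV \<and>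
     (\<forall>c\<in>A. \<forall>c'\<in>A. smooth_on (coord c ` (chart_dom c \<inter> chart_dom c')) (coord c' \<circ> coord_inv c))"

definition smooth_function :: "('m, 'n::finite) chart set \<Rightarrow> ('m \<Rightarrow> real) \<Rightarrow> bool" where
  "smooth_function A f \<longleftrightarrow> (\<forall>c\<in>A. smooth_on (chart_image c) (f \<circ> coord_inv c))"


section \<open>Vector fields and metrics\<close>

text \<open>With respect to a chart \<open>c\<close> around \<open>p\<close>, the tangent space at \<open>p\<close> is identified with
  \<open>real ^ 'n\<close> by means of the coordinate basis. A tensor field is the family of its
  components: its value at \<open>c\<close> and \<open>p\<close> is its coordinate representation at \<open>p\<close> in the chart \<open>c\<close>,
  and it is unspecified for \<open>p\<close> outside the domain of \<open>c\<close>. Representations in different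
  charts are related by the Jacobian \<open>jacobian c c' p\<close> of the change of coordinates.\<close>

definition jacobian ::
    "('m, 'n::finite) chart \<Rightarrow> ('m, 'n) chart \<Rightarrow> 'm \<Rightarrow> real ^ 'n \<Rightarrow> real ^ 'n" where
  "jacobian c c' p = frechet_derivative (coord c' \<circ> coord_inv c) (at (coord c p))"

type_synonym ('m, 'n) vfield = "('m, 'n) chart \<Rightarrow> 'm \<Rightarrow> real ^ 'n"

definition vector_field :: "('m, 'n::finite) chart set \<Rightarrow> ('m, 'n) vfield \<Rightarrow> bool" where
  "vector_field A X \<longleftrightarrow>
     (\<forall>c\<in>A. \<forall>c'\<in>A. \<forall>p\<in>chart_dom c \<inter> chart_dom c'. X c' p = jacobian c c' p (X c p)) \<and>
     (\<forall>c\<in>A. smooth_on (chart_image c) (X c \<circ> coord_inv c))"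

type_synonym 'n form = "real ^ 'n \<Rightarrow> real ^ 'n \<Rightarrow> real"

type_synonym ('m, 'n) form_field = "('m, 'n) chart \<Rightarrow> 'm \<Rightarrow> 'n form"

definition scalar_product :: "'n::finite form \<Rightarrow> bool" where
  "scalar_product b \<longleftrightarrow> bilinear b \<and> (\<forall>u v. b u v = b v u) \<and> (\<forall>u. (\<forall>v. b u v = 0) \<longrightarrow> u = 0)"

definition form_index :: "'n::finite form \<Rightarrow> nat" where
  "form_index b = Max {dim V | V. subspace V \<and> (\<forall>v\<in>V. v \<noteq> 0 \<longrightarrow> b v v < 0)}"

definition semi_riemannian_metric ::
    "('m, 'n::finite) chart set \<Rightarrow> ('m, 'n) form_field \<Rightarrow> bool" where
  "semi_riemannian_metric A g \<longleftrightarrow>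
     (\<forall>c\<in>A. \<forall>p\<in>chart_dom c. scalar_product (g c p)) \<and>
     (\<forall>c\<in>A. \<forall>c'\<in>A. \<forall>p\<in>chart_dom c \<inter> chart_dom c'. \<forall>u v.
        g c p u v = g c' p (jacobian c c' p u) (jacobian c c' p v)) \<and>
     (\<forall>c\<in>A. \<forall>u v. smooth_on (chart_image c) (\<lambda>x. g c (coord_inv c x) u v)) \<and>
     (\<exists>q. \<forall>c\<in>A. \<forall>p\<in>chart_dom c. form_index (g c p) = q)"


section \<open>Levi-Civita connection and curvature\<close>

text \<open>In this section \<open>G\<close> is the coordinate representation of a metric in a chart, i.e. a metric on
  an open subset of \<open>real ^ 'n\<close>, and \<open>X\<close>, \<open>Y\<close>, \<open>Z\<close> are vector fields on that set.\<close>

text \<open>\<open>christoffel G x u v\<close> is the covariant derivative at \<open>x\<close> of the constant field \<open>v\<close> in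
  direction \<open>u\<close>, given by the Koszul formula (constant fields commute).\<close>

definition christoffel ::
    "(real ^ 'n \<Rightarrow> 'n::finite form) \<Rightarrow> real ^ 'n \<Rightarrow> real ^ 'n \<Rightarrow> real ^ 'n \<Rightarrow> real ^ 'n" where
  "christoffel G x u v = (THE w. \<forall>z. 2 * G x w z =
      frechet_derivative (\<lambda>y. G y v z) (at x) u
    + frechet_derivative (\<lambda>y. G y u z) (at x) v
    - frechet_derivative (\<lambda>y. G y u v) (at x) z)"

definition cov_deriv ::
    "(real ^ 'n \<Rightarrow> 'n::finite form) \<Rightarrow> (real ^ 'n \<Rightarrow> real ^ 'n) \<Rightarrow> (real ^ 'n \<Rightarrow> real ^ 'n)
      \<Rightarrow> real ^ 'n \<Rightarrow> real ^ 'n" where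
  "cov_deriv G X Y x = frechet_derivative Y (at x) (X x) + christoffel G x (X x) (Y x)"

definition lie_bracket ::
    "(real ^ 'n \<Rightarrow> real ^ 'n) \<Rightarrow> (real ^ 'n::finite \<Rightarrow> real ^ 'n) \<Rightarrow> real ^ 'n \<Rightarrow> real ^ 'n" where
  "lie_bracket X Y x = frechet_derivative Y (at x) (X x) - frechet_derivative X (at x) (Y x)"

definition local_curvature ::
    "(real ^ 'n \<Rightarrow> 'n::finite form) \<Rightarrow> (real ^ 'n \<Rightarrow> real ^ 'n) \<Rightarrow> (real ^ 'n \<Rightarrow> real ^ 'n)
      \<Rightarrow> (real ^ 'n \<Rightarrow> real ^ 'n) \<Rightarrow> real ^ 'n \<Rightarrow> real ^ 'n" where
  "local_curvature G X Y Z x =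
     cov_deriv G X (cov_deriv G Y Z) x - cov_deriv G Y (cov_deriv G X Z) x
     - cov_deriv G (lie_bracket X Y) Z x"

text \<open>The curvature is a tensor, so its value on tangent vectors may be computed by extending these
  to vector fields with constant components.\<close>

definition curvature ::
    "('m, 'n::finite) form_field \<Rightarrow> ('m, 'n) chart \<Rightarrow> 'm
      \<Rightarrow> real ^ 'n \<Rightarrow> real ^ 'n \<Rightarrow> real ^ 'n \<Rightarrow> real ^ 'n" where
  "curvature g c p X Y Z =
     local_curvature (\<lambda>x. g c (coord_inv c x)) (\<lambda>_. X) (\<lambda>_. Y) (\<lambda>_. Z) (coord c p)"

definition lin_trace :: "(real ^ 'n \<Rightarrow> real ^ 'n) \<Rightarrow> real" where
  "lin_trace F = trace (matrix F)"

definition ricci :: "('m, 'n::finite) form_field \<Rightarrow> ('m, 'n) form_field" where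
  "ricci g c p Y Z = lin_trace (\<lambda>X. curvature g c p X Y Z)"

definition ricci_operator ::
    "('m, 'n::finite) form_field \<Rightarrow> ('m, 'n) chart \<Rightarrow> 'm \<Rightarrow> real ^ 'n \<Rightarrow> real ^ 'n" where
  "ricci_operator g c p X = (THE W. \<forall>Y. g c p W Y = ricci g c p X Y)"

definition scalar_curvature :: "('m, 'n::finite) form_field \<Rightarrow> ('m, 'n) chart \<Rightarrow> 'm \<Rightarrow> real" where
  "scalar_curvature g c p = lin_trace (ricci_operator g c p)"

definition ricci_square :: "('m, 'n::finite) form_field \<Rightarrow> ('m, 'n) form_field" where
  "ricci_square g c p X Y = ricci g c p (ricci_operator g c p X) Y"


section \<open>\<open>(N(k), \<xi>)\<close>-semi-Riemannian manifolds and the tensors \<open>T\<^sub>a\<close>\<close>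

text \<open>The predicate includes that \<open>A\<close> is an atlas of a smooth manifold and \<open>g\<close> is a metric on it.
  The dimension is \<open>CARD('n)\<close>.\<close>

definition Nk_semi_riemannian ::
    "('m::{t2_space, second_countable_topology}, 'n::finite) chart set \<Rightarrow> ('m, 'n) form_field
      \<Rightarrow> ('m, 'n) vfield \<Rightarrow> real \<Rightarrow> real \<Rightarrow> bool" where
  "Nk_semi_riemannian A g \<xi> k \<epsilon> \<longleftrightarrow>
     smooth_atlas A \<and> semi_riemannian_metric A g \<and> vector_field A \<xi> \<and> \<epsilon> \<in> {1, -1} \<and>
     (\<forall>c\<in>A. \<forall>p\<in>chart_dom c. g c p (\<xi> c p) (\<xi> c p) = \<epsilon> \<and>
        (\<forall>X Y. curvature g c p X Y (\<xi> c p) =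
           k *\<^sub>R (g c p Y (\<xi> c p) *\<^sub>R X - g c p X (\<xi> c p) *\<^sub>R Y)))"

definition eta_form ::
    "('m, 'n::finite) form_field \<Rightarrow> ('m, 'n) vfield \<Rightarrow> real \<Rightarrow> ('m, 'n) chart \<Rightarrow> 'm
      \<Rightarrow> real ^ 'n \<Rightarrow> real" where
  "eta_form g \<xi> \<epsilon> c p X = \<epsilon> * g c p X (\<xi> c p)"

text \<open>The eight coefficients are the values \<open>a 0, \<dots>, a 7\<close>; the other values of \<open>a\<close> are not used.\<close>

definition T_curvature ::
    "(nat \<Rightarrow> real) \<Rightarrow> ('m, 'n::finite) form_field \<Rightarrow> ('m, 'n) chart \<Rightarrow> 'm
      \<Rightarrow> real ^ 'n \<Rightarrow> real ^ 'n \<Rightarrow> real ^ 'n \<Rightarrow> real ^ 'n" where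
  "T_curvature a g c p X Y Z =
     a 0 *\<^sub>R curvature g c p X Y Z
   + (a 1 * ricci g c p Y Z) *\<^sub>R X
   + (a 2 * ricci g c p X Z) *\<^sub>R Y
   + (a 3 * ricci g c p X Y) *\<^sub>R Z
   + (a 4 * g c p Y Z) *\<^sub>R ricci_operator g c p X
   + (a 5 * g c p X Z) *\<^sub>R ricci_operator g c p Y
   + (a 6 * g c p X Y) *\<^sub>R ricci_operator g c p Z
   + (a 7 * scalar_curvature g c p) *\<^sub>R (g c p Y Z *\<^sub>R X - g c p X Z *\<^sub>R Y)"

definition T_ricci :: "(nat \<Rightarrow> real) \<Rightarrow> ('m, 'n::finite) form_field \<Rightarrow> ('m, 'n) form_field" where
  "T_ricci a g c p Y Z = lin_trace (\<lambda>X. T_curvature a g c p X Y Z)"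

text \<open>\<open>act F K\<close> is the derivation action \<open>F \<cdot> K\<close> of an endomorphism on a bilinear form.\<close>

definition act :: "(real ^ 'n \<Rightarrow> real ^ 'n) \<Rightarrow> 'n form \<Rightarrow> 'n form" where
  "act F K U V = - K (F U) V - K U (F V)"

definition wedge :: "'n form \<Rightarrow> real ^ 'n \<Rightarrow> real ^ 'n \<Rightarrow> real ^ 'n \<Rightarrow> real ^ 'n" where
  "wedge b X Y Z = b Y Z *\<^sub>R X - b X Z *\<^sub>R Y"

text \<open>\<open>M\<close> is \<open>(T\<^sub>a, S\<^bsub>T\<^sub>b\<^esub>)\<close>-pseudosymmetric with function \<open>L\<close>.\<close>

definition pseudosymmetric ::
    "('m, 'n::finite) chart set \<Rightarrow> ('m, 'n) form_field \<Rightarrow> (nat \<Rightarrow> real) \<Rightarrow> (nat \<Rightarrow> real)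
      \<Rightarrow> ('m \<Rightarrow> real) \<Rightarrow> bool" where
  "pseudosymmetric A g a b L \<longleftrightarrow> smooth_function A L \<and>
     (\<forall>c\<in>A. \<forall>p\<in>chart_dom c. \<forall>X Y U V.
        act (T_curvature a g c p X Y) (T_ricci b g c p) U V =
        L p * act (wedge (g c p) X Y) (T_ricci b g c p) U V)"

end

theory Submission
  imports Defs
begin

text \<open>Evaluating the pseudosymmetry condition at \<open>X = V = \<xi>\<close> gives the identity, because every
  term then becomes explicit. Write \<open>\<kappa> = k (n - 1)\<close>. Contracting \<open>R(X,Y)\<xi>\<close> gives
  \<open>S(Y,\<xi>) = \<kappa> g(Y,\<xi>)\<close>, hence \<open>Q\<xi> = \<kappa> \<xi>\<close>, and \<open>S\<^bsub>T\<^sub>b\<^esub> = B S + D g\<close> satisfies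
  \<open>S\<^bsub>T\<^sub>b\<^esub>(Z,\<xi>) = (B \<kappa> + D) g(Z,\<xi>)\<close>. So the first half of the derivation,
  \<open>S\<^bsub>T\<^sub>b\<^esub>(T\<^sub>a(\<xi>,Y)U, \<xi>)\<close>, only sees the \<open>\<xi>\<close>-component of \<open>T\<^sub>a(\<xi>,Y)U\<close>, and the second half,
  \<open>S\<^bsub>T\<^sub>b\<^esub>(U, T\<^sub>a(\<xi>,Y)\<xi>)\<close>, is a combination of \<open>\<eta>(Y)\<eta>(U)\<close>, \<open>S\<^bsub>T\<^sub>b\<^esub>(Y,U)\<close> and
  \<open>S\<^bsub>T\<^sub>b\<^esub>(U,QY)\<close>; the last one produces the term with \<open>S\<^sup>2\<close>.

  This computation uses three facts about the curvature that are not part of its definition by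
  coordinates: \<open>R(X,Y)Z\<close> is linear in \<open>Y\<close>, \<open>R(X,Y)\<close> is skew with respect to \<open>g\<close> (which yields the
  \<open>\<xi>\<close>-component of \<open>R(\<xi>,Y)U\<close>), and \<open>S\<close> is symmetric, hence a bilinear
  form. Skewness (\<open>Riem_skew\<close>) follows by
  differentiating the compatibility of the connection with the metric once more: the second
  derivatives of \<open>g\<close> cancel by their symmetry (\<open>symmetric_directional_derivatives\<close>). For this the
  Christoffel map has to be differentiable, which is Cramer's rule applied to the Koszul formula
  (\<open>linear_system_solution_differentiable\<close>). Symmetry of \<open>S\<close> (\<open>ricci_sym\<close>) follows from the first
  Bianchi identity, because \<open>S(Y,Z) - S(Z,Y)\<close> is minus the trace of the skew map \<open>R(Y,Z)\<close>, and skew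
  maps have trace zero (\<open>lin_trace_skew\<close>).\<close>

section \<open>Symmetry of second derivatives\<close>

lemma smooth_on_differentiable:
  assumes "smooth_on S f" "x \<in> S"
  shows "f differentiable (at x)"
proof -
  have "Ck_on (Suc 0) S f"
    using assms(1) by (simp only: smooth_on_def)
  then show ?thesis
    using assms(2) by simp
qed

lemma smooth_on_continuous:
  assumes "smooth_on S f"
  shows "continuous_on S f"
proof -
  have "Ck_on 0 S f"
    using assms by (simp only: smooth_on_def)
  then show ?thesis
    by simp
qed

lemma smooth_on_directional_derivative:
  assumes "smooth_on S f"
  shows "smooth_on S (\<lambda>x. frechet_derivative f (at x) v)"
  unfolding smooth_on_def
proof
  fix k
  have "Ck_on (Suc k) S f"
    using assms by (simp only: smooth_on_def)
  then show "Ck_on k S (\<lambda>x. frechet_derivative f (at x) v)"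
    by simp
qed

lemma directional_derivative_DERIV:
  fixes f :: "'a::real_normed_vector \<Rightarrow> real"
  assumes "f differentiable (at (x + s *\<^sub>R u))"
  shows "((\<lambda>s. f (x + s *\<^sub>R u)) has_field_derivative frechet_derivative f (at (x + s *\<^sub>R u)) u) (at s)"
proof -
  let ?D = "frechet_derivative f (at (x + s *\<^sub>R u))"
  have D: "(f has_derivative ?D) (at (x + s *\<^sub>R u))"
    using assms frechet_derivative_works by blast
  have "((\<lambda>s. x + s *\<^sub>R u) has_derivative (\<lambda>h. h *\<^sub>R u)) (at s)"
    by (auto intro!: derivative_eq_intros)
  from has_derivative_compose[OF this D]
  have "((\<lambda>s. f (x + s *\<^sub>R u)) has_derivative (\<lambda>h. ?D (h *\<^sub>R u))) (at s)" .
  moreover have "(\<lambda>h. ?D (h *\<^sub>R u)) = (*) (?D u)"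
    using linear_scale[OF has_derivative_linear[OF D]] by (auto simp: fun_eq_iff)
  ultimately show ?thesis
    by (simp add: has_field_derivative_def)
qed

text \<open>The mean value theorem applied twice to the second difference of \<open>f\<close> over a parallelogram: first
  along \<open>u\<close> to the difference of two opposite sides, then along \<open>v\<close> to the derivative so obtained.\<close>

lemma second_difference_mean_value:
  fixes f :: "'a::real_normed_vector \<Rightarrow> real"
  assumes "0 < t"
    and S: "\<And>s r. \<lbrakk>0 \<le> s; s \<le> t; 0 \<le> r; r \<le> t\<rbrakk> \<Longrightarrow> x + s *\<^sub>R u + r *\<^sub>R v \<in> S"
    and f: "\<And>y. y \<in> S \<Longrightarrow> f differentiable (at y)"
    and fu: "\<And>y. y \<in> S \<Longrightarrow> (\<lambda>z. frechet_derivative f (at z) u) differentiable (at y)"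
  obtains s r where "0 < s" "s < t" "0 < r" "r < t"
    "f (x + t *\<^sub>R u + t *\<^sub>R v) - f (x + t *\<^sub>R u) - f (x + t *\<^sub>R v) + f x
      = t * t * frechet_derivative (\<lambda>z. frechet_derivative f (at z) u) (at (x + s *\<^sub>R u + r *\<^sub>R v)) v"
proof -
  let ?fu = "\<lambda>z. frechet_derivative f (at z) u"
  let ?\<phi> = "\<lambda>s. f (x + s *\<^sub>R u + t *\<^sub>R v) - f (x + s *\<^sub>R u)"
  have "DERIV ?\<phi> s :> ?fu (x + s *\<^sub>R u + t *\<^sub>R v) - ?fu (x + s *\<^sub>R u)" if "0 \<le> s" "s \<le> t" for s
  proof -
    have 1: "x + s *\<^sub>R u + t *\<^sub>R v \<in> S" "x + s *\<^sub>R u \<in> S"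
      using S[of s t] S[of s 0] that \<open>0 < t\<close> by auto
    have "((\<lambda>s. f (x + t *\<^sub>R v + s *\<^sub>R u)) has_field_derivative ?fu (x + t *\<^sub>R v + s *\<^sub>R u)) (at s)"
      by (rule directional_derivative_DERIV) (use f 1 in \<open>simp add: algebra_simps\<close>)
    moreover have "((\<lambda>s. f (x + s *\<^sub>R u)) has_field_derivative ?fu (x + s *\<^sub>R u)) (at s)"
      by (rule directional_derivative_DERIV) (use f 1 in simp)
    ultimately show ?thesis
      by (simp add: algebra_simps DERIV_diff)
  qed
  from MVT2[OF \<open>0 < t\<close> this] obtain s where s: "0 < s" "s < t"
    and *: "?\<phi> t - ?\<phi> 0 = t * (?fu (x + s *\<^sub>R u + t *\<^sub>R v) - ?fu (x + s *\<^sub>R u))"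
    by auto
  have "DERIV (\<lambda>r. ?fu (x + s *\<^sub>R u + r *\<^sub>R v)) r
      :> frechet_derivative ?fu (at (x + s *\<^sub>R u + r *\<^sub>R v)) v" if "0 \<le> r" "r \<le> t" for r
    by (rule directional_derivative_DERIV[OF fu]) (use S that s in auto)
  from MVT2[OF \<open>0 < t\<close> this] obtain r where r: "0 < r" "r < t"
    and **: "?fu (x + s *\<^sub>R u + t *\<^sub>R v) - ?fu (x + s *\<^sub>R u)
      = t * frechet_derivative ?fu (at (x + s *\<^sub>R u + r *\<^sub>R v)) v"
    by auto
  show ?thesis
    by (rule that[OF s r]) (use * ** in \<open>simp add: algebra_simps\<close>)
qed

text \<open>The second difference is symmetric in \<open>u\<close> and \<open>v\<close>, so the two mixed derivatives agree at a pair of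
  points of an arbitrarily small parallelogram at \<open>x\<close>. By continuity they agree at \<open>x\<close>.\<close>

lemma symmetric_directional_derivatives:
  fixes f :: "'a::real_normed_vector \<Rightarrow> real"
  assumes "open S" "x \<in> S" "smooth_on S f"
  shows "frechet_derivative (\<lambda>z. frechet_derivative f (at z) u) (at x) v
       = frechet_derivative (\<lambda>z. frechet_derivative f (at z) v) (at x) u"
proof -
  define F where "F u v y = frechet_derivative (\<lambda>z. frechet_derivative f (at z) u) (at y) v" for u v y
  have f: "f differentiable (at y)" if "y \<in> S" for y
    using assms that smooth_on_differentiable by blast
  have fw: "(\<lambda>z. frechet_derivative f (at z) w) differentiable (at y)" if "y \<in> S" for y w
    using assms that smooth_on_differentiable smooth_on_directional_derivative by blast
  have cont: "continuous_on S (F u v)" for u v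
    unfolding F_def
    by (intro smooth_on_continuous smooth_on_directional_derivative assms)
  have "\<bar>F u v x - F v u x\<bar> < e" if "e > 0" for e
  proof -
    obtain d1 where d1: "d1 > 0" "\<And>y. y \<in> S \<Longrightarrow> dist y x < d1 \<Longrightarrow> dist (F u v y) (F u v x) < e / 2"
      using cont[of u v] \<open>x \<in> S\<close> \<open>e > 0\<close> unfolding continuous_on_iff by (meson half_gt_zero)
    obtain d2 where d2: "d2 > 0" "\<And>y. y \<in> S \<Longrightarrow> dist y x < d2 \<Longrightarrow> dist (F v u y) (F v u x) < e / 2"
      using cont[of v u] \<open>x \<in> S\<close> \<open>e > 0\<close> unfolding continuous_on_iff by (meson half_gt_zero)
    obtain d3 where d3: "d3 > 0" "ball x d3 \<subseteq> S"
      using \<open>open S\<close> \<open>x \<in> S\<close> open_contains_ball by blast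
    define d where "d = min d1 (min d2 d3)"
    \<comment> \<open>so small that the parallelogram with sides \<open>t u\<close> and \<open>t v\<close> lies in the ball of radius \<open>d\<close>;
      the summand \<open>1\<close> covers the case \<open>u = v = 0\<close>\<close>
    define t where "t = d / (2 * (norm u + norm v + 1))"
    have d: "d > 0" using d1 d2 d3 by (simp add: d_def)
    have pos: "norm u + norm v + 1 > 0" by (smt (verit) norm_ge_zero)
    have t: "t > 0" using d pos by (simp add: t_def)
    have "t * (norm u + norm v) < d"
    proof -
      have "t * (norm u + norm v) < t * (2 * (norm u + norm v + 1))"
        using t pos by (intro mult_strict_left_mono) (auto intro: add_nonneg_pos)
      also have "\<dots> = d" using pos by (simp add: t_def)
      finally show ?thesis .
    qed
    then have near: "dist (x + s *\<^sub>R u + r *\<^sub>R v) x < d" if "0 \<le> s" "s \<le> t" "0 \<le> r" "r \<le> t" for s r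
    proof -
      have "dist (x + s *\<^sub>R u + r *\<^sub>R v) x \<le> s * norm u + r * norm v"
        using norm_triangle_ineq[of "s *\<^sub>R u" "r *\<^sub>R v"] that by (simp add: dist_norm)
      also have "\<dots> \<le> t * norm u + t * norm v"
        using that by (intro add_mono mult_right_mono) auto
      also have "\<dots> < d" using \<open>t * (norm u + norm v) < d\<close> by (simp add: algebra_simps)
      finally show ?thesis .
    qed
    have inS: "x + s *\<^sub>R u + r *\<^sub>R v \<in> S" if "0 \<le> s" "s \<le> t" "0 \<le> r" "r \<le> t" for s r
      using near[OF that] d3 by (auto simp: d_def dist_commute)
    have inS': "x + r *\<^sub>R v + s *\<^sub>R u \<in> S" if "0 \<le> r" "r \<le> t" "0 \<le> s" "s \<le> t" for s r
      using inS[of s r] that by (simp add: algebra_simps)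
    obtain s r where sr: "0 < s" "s < t" "0 < r" "r < t"
      and 1: "f (x + t *\<^sub>R u + t *\<^sub>R v) - f (x + t *\<^sub>R u) - f (x + t *\<^sub>R v) + f x
         = t * t * F u v (x + s *\<^sub>R u + r *\<^sub>R v)"
      unfolding F_def using second_difference_mean_value[OF t inS f fw] by blast
    obtain r' s' where sr': "0 < r'" "r' < t" "0 < s'" "s' < t"
      and 2: "f (x + t *\<^sub>R v + t *\<^sub>R u) - f (x + t *\<^sub>R v) - f (x + t *\<^sub>R u) + f x
         = t * t * F v u (x + r' *\<^sub>R v + s' *\<^sub>R u)"
      unfolding F_def using second_difference_mean_value[OF t inS' f fw] by blast
    have "t * t * F u v (x + s *\<^sub>R u + r *\<^sub>R v) = t * t * F v u (x + r' *\<^sub>R v + s' *\<^sub>R u)"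
      using 1 2 by (simp add: algebra_simps)
    then have "F u v (x + s *\<^sub>R u + r *\<^sub>R v) = F v u (x + s' *\<^sub>R u + r' *\<^sub>R v)"
      using t by (simp add: algebra_simps)
    moreover have "dist (F u v (x + s *\<^sub>R u + r *\<^sub>R v)) (F u v x) < e / 2"
      using d1(2)[OF inS near[unfolded d_def, THEN order.strict_trans2]] sr by auto
    moreover have "dist (F v u (x + s' *\<^sub>R u + r' *\<^sub>R v)) (F v u x) < e / 2"
      using d2(2)[OF inS near[unfolded d_def, THEN order.strict_trans2]] sr' by auto
    ultimately show ?thesis
      unfolding dist_real_def by linarith
  qed
  from this[of "\<bar>F u v x - F v u x\<bar>"] have "F u v x = F v u x"
    by fastforce
  then show ?thesis
    by (simp add: F_def)
qed

section \<open>Differentiability of solutions of linear systems\<close>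

lemma differentiable_prod:
  fixes f :: "'i \<Rightarrow> 'a::real_normed_vector \<Rightarrow> real"
  assumes "\<And>i. i \<in> I \<Longrightarrow> f i differentiable (at x)"
  shows "(\<lambda>y. \<Prod>i\<in>I. f i y) differentiable (at x)"
proof (rule differentiableI, rule has_derivative_prod)
  show "(f i has_derivative frechet_derivative (f i) (at x)) (at x)" if "i \<in> I" for i
    using assms[OF that] frechet_derivative_works by blast
qed

lemma differentiable_det:
  fixes M :: "'a::real_normed_vector \<Rightarrow> real ^ 'n ^ 'n"
  assumes "\<And>i j. (\<lambda>y. M y $ i $ j) differentiable (at x)"
  shows "(\<lambda>y. det (M y)) differentiable (at x)"
  unfolding det_def
  by (intro differentiable_sum ballI differentiable_mult differentiable_const differentiable_prod assms) auto

lemma vec_differentiableI: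
  fixes w :: "'a::real_normed_vector \<Rightarrow> real ^ 'n"
  assumes "\<And>i. (\<lambda>y. w y $ i) differentiable (at x)"
  shows "w differentiable (at x)"
proof -
  have "(\<lambda>y. \<Sum>i\<in>UNIV. (w y $ i) *\<^sub>R axis i (1::real)) differentiable (at x)"
    by (intro differentiable_sum ballI differentiable_scaleR differentiable_const assms) auto
  then show ?thesis
    by (simp add: basis_expansion flip: scalar_mult_eq_scaleR)
qed

text \<open>Cramer's rule writes the solution as a quotient of determinants, which are polynomials in the
  coefficients.\<close>

lemma linear_system_solution_differentiable:
  fixes M :: "'a::real_normed_vector \<Rightarrow> real ^ 'n ^ 'n" and b w :: "'a \<Rightarrow> real ^ 'n"
  assumes "open S" "x \<in> S"
    and M: "\<And>i j. (\<lambda>y. M y $ i $ j) differentiable (at x)"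
    and b: "\<And>i. (\<lambda>y. b y $ i) differentiable (at x)"
    and det: "\<And>y. y \<in> S \<Longrightarrow> det (M y) \<noteq> 0"
    and w: "\<And>y. y \<in> S \<Longrightarrow> M y *v w y = b y"
  shows "w differentiable (at x)"
proof (rule vec_differentiableI)
  fix i
  define N where "N y = (\<chi> k j. if j = i then b y $ k else M y $ k $ j)" for y
  have "(\<lambda>y. N y $ k $ j) differentiable (at x)" for k j
    unfolding N_def by (cases "j = i") (simp_all add: M b)
  then have "(\<lambda>y. det (N y) / det (M y)) differentiable (at x)"
    by (intro differentiable_divide differentiable_det M det \<open>x \<in> S\<close>)
  then obtain D where D: "((\<lambda>y. det (N y) / det (M y)) has_derivative D) (at x)"
    unfolding differentiable_def by blast
  have "det (N y) / det (M y) = w y $ i" if "y \<in> S" for y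
    using cramer[OF det[OF that], of "w y" "b y"] w[OF that] by (simp add: N_def)
  from has_derivative_transform_within_open[OF D assms(1,2) this]
  show "(\<lambda>y. w y $ i) differentiable (at x)"
    by (rule differentiableI)
qed

section \<open>Scalar products and traces\<close>

lemma linear_axis_expansion:
  fixes f :: "real ^ 'n \<Rightarrow> real"
  assumes "linear f"
  shows "f w = (\<Sum>i\<in>UNIV. w $ i * f (axis i 1))"
proof -
  have "f w = f (\<Sum>i\<in>UNIV. (w $ i) *\<^sub>R axis i 1)"
    by (simp add: basis_expansion flip: scalar_mult_eq_scaleR)
  also have "\<dots> = (\<Sum>i\<in>UNIV. w $ i * f (axis i 1))"
    by (simp add: linear_sum[OF assms] linear_scale[OF assms])
  finally show ?thesis .
qed

lemma linear_eq_on_axes: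
  fixes f h :: "real ^ 'n \<Rightarrow> real"
  assumes "linear f" "linear h" "\<And>i. f (axis i 1) = h (axis i 1)"
  shows "f = h"
proof
  show "f w = h w" for w
    unfolding linear_axis_expansion[OF assms(1), of w] linear_axis_expansion[OF assms(2), of w]
    by (simp add: assms(3))
qed

context
  fixes b :: "'n::finite form"
  assumes b: "scalar_product b"
begin

lemma scalar_product_bilinear: "bilinear b"
  and scalar_product_sym: "b u v = b v u"
  using b by (simp_all add: scalar_product_def)

lemma scalar_product_eqI:
  assumes "\<And>z. b v z = b w z"
  shows "v = w"
proof -
  have "b (v - w) z = 0" for z
    using assms by (simp add: bilinear_lsub[OF scalar_product_bilinear])
  then show ?thesis
    using b unfolding scalar_product_def by (metis eq_iff_diff_eq_0)
qed

lemma linear_scalar_product_left: "linear (\<lambda>u. b u v)"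
  and linear_scalar_product_right: "linear (b u)"
  using scalar_product_bilinear by (simp_all add: bilinear_def)

text \<open>The Gram matrix turns the equation \<open>b w z = f z\<close> for all \<open>z\<close> into a linear system for \<open>w\<close>.\<close>

lemma gram_matrix_mult:
  "((\<chi> i j. b (axis j 1) (axis i 1)) *v w) $ i = b w (axis i 1)"
  using linear_axis_expansion[OF linear_scalar_product_left, of w "axis i 1"]
  by (simp add: matrix_vector_mult_def mult.commute)

lemma invertible_gram_matrix: "invertible ((\<chi> i j. b (axis j 1) (axis i 1)) :: real ^ 'n ^ 'n)"
proof -
  have "v = 0" if "(\<chi> i j. b (axis j 1) (axis i 1)) *v v = 0" for v
  proof (rule scalar_product_eqI)
    have "b v (axis i 1) = 0" for i
      using arg_cong[OF that, of "\<lambda>w. w $ i"] by (simp only: gram_matrix_mult) simp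
    then have "b v = (\<lambda>_. 0)"
      by (intro linear_eq_on_axes linear_scalar_product_right) (auto simp: linear_zero)
    then show "b v z = b 0 z" for z
      by (simp add: bilinear_lzero[OF scalar_product_bilinear])
  qed
  then show ?thesis
    by (simp add: invertible_left_inverse matrix_left_invertible_ker)
qed

lemma scalar_product_represents:
  assumes "linear f"
  shows "\<exists>!w. \<forall>z. b w z = f z"
proof -
  let ?M = "(\<chi> i j. b (axis j 1) (axis i 1)) :: real ^ 'n ^ 'n"
  obtain C where "?M ** C = mat 1"
    using invertible_gram_matrix unfolding invertible_def by blast
  then have "?M *v (C *v (\<chi> i. f (axis i 1))) = (\<chi> i. f (axis i 1))"
    by (simp add: matrix_vector_mul_assoc)
  then obtain w where "?M *v w = (\<chi> i. f (axis i 1))"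
    by blast
  then have "b w (axis i 1) = f (axis i 1)" for i
    using gram_matrix_mult[of w i] by simp
  then have "b w = f"
    by (intro linear_eq_on_axes linear_scalar_product_right assms)
  then show ?thesis
    using scalar_product_eqI by (intro ex1I[of _ w]) auto
qed

text \<open>With the Gram matrix \<open>B\<close>, skewness of \<open>F\<close> reads \<open>F\<^sup>T B = - B F\<close>, so \<open>F = - B\<^sup>-\<^sup>1 F\<^sup>T B\<close> has the
  same trace as \<open>- F\<^sup>T\<close>.\<close>

lemma lin_trace_skew:
  assumes skew: "\<And>u v. b (F u) v = - b u (F v)"
  shows "lin_trace F = 0"
proof -
  define B where "B = ((\<chi> i j. b (axis j 1) (axis i 1)) :: real ^ 'n ^ 'n)"
  have Bij: "B $ i $ j = b (axis j 1) (axis i 1)" for i j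
    by (simp add: B_def)
  have Bsym: "transpose B = B"
    by (simp add: B_def transpose_def vec_eq_iff scalar_product_sym)
  have BF: "(B ** matrix F) $ i $ j = b (F (axis j 1)) (axis i 1)" for i j
    using gram_matrix_mult[of "F (axis j 1)" i]
    by (simp add: matrix_matrix_mult_def matrix_vector_mult_def matrix_def Bij)
  have "transpose (B ** matrix F) = - (B ** matrix F)"
    by (simp add: vec_eq_iff transpose_def BF) (metis skew scalar_product_sym)
  then have eq: "transpose (matrix F) ** B = - (B ** matrix F)"
    by (simp add: matrix_transpose_mul Bsym)
  obtain C where inv: "C ** B = mat 1" "B ** C = mat 1"
    using invertible_gram_matrix unfolding B_def invertible_def by blast
  have "trace (matrix F) = trace (C ** (B ** matrix F))"
    by (simp add: matrix_mul_assoc inv)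
  also have "B ** matrix F = - (transpose (matrix F) ** B)"
    by (simp add: eq)
  also have "trace (C ** (- (transpose (matrix F) ** B))) = - trace (C ** (transpose (matrix F) ** B))"
    by (simp add: trace_def matrix_matrix_mult_def sum_negf)
  also have "trace (C ** (transpose (matrix F) ** B)) = trace (transpose (matrix F) ** (B ** C))"
    by (metis matrix_mul_assoc trace_mul_sym)
  also have "\<dots> = trace (matrix F)"
    by (simp add: inv trace_def transpose_def)
  finally show ?thesis
    by (simp add: lin_trace_def)
qed

end

lemma lin_trace_add: "lin_trace (\<lambda>X. F X + H X) = lin_trace F + lin_trace H"
  and lin_trace_diff: "lin_trace (\<lambda>X. F X - H X) = lin_trace F - lin_trace H"
  and lin_trace_minus: "lin_trace (\<lambda>X. - F X) = - lin_trace F"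
  and lin_trace_scale: "lin_trace (\<lambda>X. r *\<^sub>R F X) = r * lin_trace F"
  by (simp_all add: lin_trace_def trace_def matrix_def sum.distrib sum_subtractf sum_negf sum_distrib_left)

lemma lin_trace_ident: "lin_trace (\<lambda>X :: real ^ 'n. X) = real CARD('n)"
  by (simp add: lin_trace_def trace_def matrix_def axis_def)

lemma lin_trace_rank_one:
  fixes Y :: "real ^ 'n"
  assumes "linear f"
  shows "lin_trace (\<lambda>X. f X *\<^sub>R Y) = f Y"
  using linear_axis_expansion[OF assms, of Y]
  by (simp add: lin_trace_def trace_def matrix_def mult.commute)

section \<open>Curvature of a metric on an open subset of \<open>real ^ 'n\<close>\<close>

locale local_metric =
  fixes \<Omega> :: "(real ^ 'n::finite) set" and G :: "real ^ 'n \<Rightarrow> 'n form"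
  assumes open_domain: "open \<Omega>"
    and scalar_product: "x \<in> \<Omega> \<Longrightarrow> scalar_product (G x)"
    and smooth: "smooth_on \<Omega> (\<lambda>x. G x u v)"
begin

text \<open>The argument \<open>h\<close> of \<open>dG\<close> and \<open>d\<Gamma>\<close> is the direction of differentiation.\<close>

definition dG :: "real ^ 'n \<Rightarrow> real ^ 'n \<Rightarrow> real ^ 'n \<Rightarrow> real ^ 'n \<Rightarrow> real" where
  "dG x u v h = frechet_derivative (\<lambda>y. G y u v) (at x) h"

abbreviation \<Gamma> :: "real ^ 'n \<Rightarrow> real ^ 'n \<Rightarrow> real ^ 'n \<Rightarrow> real ^ 'n" where
  "\<Gamma> \<equiv> christoffel G"

definition d\<Gamma> :: "real ^ 'n \<Rightarrow> real ^ 'n \<Rightarrow> real ^ 'n \<Rightarrow> real ^ 'n \<Rightarrow> real ^ 'n" where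
  "d\<Gamma> x u v h = frechet_derivative (\<lambda>y. \<Gamma> y u v) (at x) h"

lemmas G_bilinear = scalar_product_bilinear[OF scalar_product]
lemmas G_sym = scalar_product_sym[OF scalar_product]
lemmas G_simps =
  bilinear_ladd[OF G_bilinear] bilinear_radd[OF G_bilinear]
  bilinear_lsub[OF G_bilinear] bilinear_rsub[OF G_bilinear]
  bilinear_lmul[OF G_bilinear] bilinear_rmul[OF G_bilinear]

lemma G_has_derivative: "x \<in> \<Omega> \<Longrightarrow> ((\<lambda>y. G y u v) has_derivative dG x u v) (at x)"
  unfolding dG_def
  using smooth_on_differentiable[OF smooth] frechet_derivative_works by blast

text \<open>Frechet derivatives only depend on values near \<open>x\<close>. The algebraic properties of the metric, which
  are known on \<open>\<Omega>\<close> only, therefore pass to its derivative; likewise for \<open>\<Gamma>\<close> below.\<close>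

lemma dG_eqI:
  assumes "x \<in> \<Omega>" "(f has_derivative f') (at x)" "\<And>y. y \<in> \<Omega> \<Longrightarrow> f y = G y u v"
  shows "dG x u v = f'"
  using has_derivative_unique G_has_derivative
    has_derivative_transform_within_open[OF assms(2) open_domain assms(1,3)] assms(1) by blast

lemma dG_sym: "x \<in> \<Omega> \<Longrightarrow> dG x u v h = dG x v u h"
  by (subst dG_eqI[OF _ G_has_derivative]) (auto simp: G_sym)

lemma dG_add_left: "x \<in> \<Omega> \<Longrightarrow> dG x (u + u') v h = dG x u v h + dG x u' v h"
  by (subst dG_eqI[OF _ has_derivative_add[OF G_has_derivative G_has_derivative]])
     (auto simp: G_simps)

lemma dG_scale_left: "x \<in> \<Omega> \<Longrightarrow> dG x (r *\<^sub>R u) v h = r * dG x u v h"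
  by (subst dG_eqI[OF _ has_derivative_mult_right[OF G_has_derivative]])
     (auto simp: G_simps)

lemma dG_add_right: "x \<in> \<Omega> \<Longrightarrow> dG x u (v + v') h = dG x u v h + dG x u v' h"
  and dG_scale_right: "x \<in> \<Omega> \<Longrightarrow> dG x u (r *\<^sub>R v) h = r * dG x u v h"
  by (metis dG_sym dG_add_left, metis dG_sym dG_scale_left)

lemma dG_linear: "x \<in> \<Omega> \<Longrightarrow> linear (dG x u v)"
  by (rule has_derivative_linear[OF G_has_derivative])

lemmas dG_add = linear_add[OF dG_linear]
lemmas dG_scale = linear_scale[OF dG_linear, unfolded real_scaleR_def]

text \<open>The defining property of \<open>christoffel\<close> really determines it: the right-hand side of the Koszul
  formula is linear in \<open>z\<close>, so nondegeneracy represents it by a unique vector.\<close>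

lemma koszul:
  assumes "x \<in> \<Omega>"
  shows "2 * G x (\<Gamma> x u v) z = dG x v z u + dG x u z v - dG x u v z"
proof -
  let ?f = "\<lambda>z. (dG x v z u + dG x u z v - dG x u v z) / 2"
  have "linear ?f"
    using assms
    by (auto intro!: linearI
      simp: dG_add_right dG_scale_right dG_add dG_scale algebra_simps add_divide_distrib diff_divide_distrib)
  from scalar_product_represents[OF scalar_product[OF assms] this]
  have "\<exists>!w. \<forall>z. 2 * G x w z = dG x v z u + dG x u z v - dG x u v z"
    by (simp add: field_simps)
  from theI'[OF this] show ?thesis
    unfolding christoffel_def dG_def by blast
qed

lemma \<Gamma>_eqI:
  assumes "x \<in> \<Omega>" "\<And>z. 2 * G x w z = dG x v z u + dG x u z v - dG x u v z"
  shows "\<Gamma> x u v = w"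
  using koszul[OF assms(1)] assms(2)
  by (intro scalar_product_eqI[OF scalar_product[OF assms(1)]]) (smt (verit))

lemma \<Gamma>_sym: "x \<in> \<Omega> \<Longrightarrow> \<Gamma> x u v = \<Gamma> x v u"
  by (rule \<Gamma>_eqI) (auto simp: koszul dG_sym[of x u v])

lemma \<Gamma>_add_left: "x \<in> \<Omega> \<Longrightarrow> \<Gamma> x (u + u') v = \<Gamma> x u v + \<Gamma> x u' v"
  by (rule \<Gamma>_eqI) (auto simp: koszul G_simps dG_add dG_add_left distrib_left)

lemma \<Gamma>_scale_left: "x \<in> \<Omega> \<Longrightarrow> \<Gamma> x (r *\<^sub>R u) v = r *\<^sub>R \<Gamma> x u v"
proof (rule \<Gamma>_eqI)
  fix z assume x: "x \<in> \<Omega>"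
  have "2 * G x (r *\<^sub>R \<Gamma> x u v) z = r * (2 * G x (\<Gamma> x u v) z)"
    using x by (simp add: G_simps)
  also have "\<dots> = r * dG x v z u + r * dG x u z v - r * dG x u v z"
    unfolding koszul[OF x] by (simp only: right_diff_distrib distrib_left)
  finally show "2 * G x (r *\<^sub>R \<Gamma> x u v) z
      = dG x v z (r *\<^sub>R u) + dG x (r *\<^sub>R u) z v - dG x (r *\<^sub>R u) v z"
    using x by (simp only: dG_scale dG_scale_left)
qed

lemma \<Gamma>_add_right: "x \<in> \<Omega> \<Longrightarrow> \<Gamma> x u (v + v') = \<Gamma> x u v + \<Gamma> x u v'"
  and \<Gamma>_scale_right: "x \<in> \<Omega> \<Longrightarrow> \<Gamma> x u (r *\<^sub>R v) = r *\<^sub>R \<Gamma> x u v"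
  by (metis \<Gamma>_sym \<Gamma>_add_left, metis \<Gamma>_sym \<Gamma>_scale_left)

text \<open>The six Koszul terms of the two summands cancel in pairs except for two, which are equal by symmetry
  of the metric.\<close>

lemma metric_compatible:
  "x \<in> \<Omega> \<Longrightarrow> dG x v w u = G x (\<Gamma> x u v) w + G x (\<Gamma> x u w) v"
  using koszul[of x u v w] koszul[of x u w v] dG_sym[of x v w u] by linarith

lemma \<Gamma>_has_derivative:
  assumes "x \<in> \<Omega>"
  shows "((\<lambda>y. \<Gamma> y u v) has_derivative d\<Gamma> x u v) (at x)"
proof -
  let ?M = "\<lambda>y. (\<chi> i j. G y (axis j 1) (axis i 1)) :: real ^ 'n ^ 'n"
  have dG: "(\<lambda>y. dG y u v h) differentiable (at x)" for u v h
    unfolding dG_def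
    by (rule smooth_on_differentiable[OF smooth_on_directional_derivative[OF smooth] assms])
  have "(\<lambda>y. \<Gamma> y u v) differentiable (at x)"
  proof (rule linear_system_solution_differentiable[OF open_domain assms])
    show "(\<lambda>y. ?M y $ i $ j) differentiable (at x)" for i j
      using smooth_on_differentiable[OF smooth assms] by simp
    show "(\<lambda>y. (\<chi> i. (dG y v (axis i 1) u + dG y u (axis i 1) v - dG y u v (axis i 1)) / 2) $ i)
        differentiable (at x)" for i
      by (simp add: dG)
    show "det (?M y) \<noteq> 0" if "y \<in> \<Omega>" for y
      using invertible_gram_matrix[OF scalar_product[OF that]] by (simp add: invertible_det_nz)
    show "?M y *v \<Gamma> y u v = (\<chi> i. (dG y v (axis i 1) u + dG y u (axis i 1) v - dG y u v (axis i 1)) / 2)"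
      if "y \<in> \<Omega>" for y
      using koszul[OF that, of u v] unfolding vec_eq_iff gram_matrix_mult[OF scalar_product[OF that]]
      by (simp add: field_simps)
  qed
  then show ?thesis
    unfolding d\<Gamma>_def using frechet_derivative_works by blast
qed

lemma d\<Gamma>_eqI:
  assumes "x \<in> \<Omega>" "(f has_derivative f') (at x)" "\<And>y. y \<in> \<Omega> \<Longrightarrow> f y = \<Gamma> y u v"
  shows "d\<Gamma> x u v = f'"
  using has_derivative_unique \<Gamma>_has_derivative
    has_derivative_transform_within_open[OF assms(2) open_domain assms(1,3)] assms(1) by blast

lemma d\<Gamma>_sym: "x \<in> \<Omega> \<Longrightarrow> d\<Gamma> x u v h = d\<Gamma> x v u h"
  by (subst d\<Gamma>_eqI[OF _ \<Gamma>_has_derivative]) (auto simp: \<Gamma>_sym)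

lemma d\<Gamma>_add_right: "x \<in> \<Omega> \<Longrightarrow> d\<Gamma> x u (v + v') h = d\<Gamma> x u v h + d\<Gamma> x u v' h"
  by (subst d\<Gamma>_eqI[OF _ has_derivative_add[OF \<Gamma>_has_derivative \<Gamma>_has_derivative]])
     (auto simp: \<Gamma>_add_right)

lemma d\<Gamma>_scale_right: "x \<in> \<Omega> \<Longrightarrow> d\<Gamma> x u (r *\<^sub>R v) h = r *\<^sub>R d\<Gamma> x u v h"
  by (subst d\<Gamma>_eqI[OF _ has_derivative_scaleR_right[OF \<Gamma>_has_derivative]])
     (auto simp: \<Gamma>_scale_right)

lemma d\<Gamma>_add_left: "x \<in> \<Omega> \<Longrightarrow> d\<Gamma> x (u + u') v h = d\<Gamma> x u v h + d\<Gamma> x u' v h"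
  and d\<Gamma>_scale_left: "x \<in> \<Omega> \<Longrightarrow> d\<Gamma> x (r *\<^sub>R u) v h = r *\<^sub>R d\<Gamma> x u v h"
  by (metis d\<Gamma>_sym d\<Gamma>_add_right, metis d\<Gamma>_sym d\<Gamma>_scale_right)

lemma d\<Gamma>_linear: "x \<in> \<Omega> \<Longrightarrow> linear (d\<Gamma> x u v)"
  by (rule has_derivative_linear[OF \<Gamma>_has_derivative])

text \<open>The product rule for a metric that varies together with its argument; expanding the argument in the
  standard basis reduces it to the product rule for real functions.\<close>

lemma G_along_field_has_derivative:
  assumes "x \<in> \<Omega>" and w: "(w has_derivative w') (at x)"
  shows "((\<lambda>y. G y (w y) z) has_derivative (\<lambda>h. dG x (w x) z h + G x (w' h) z)) (at x)"
proof -
  have lin: "linear (\<lambda>u. G y u z)" if "y \<in> \<Omega>" for y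
    by (rule linear_scalar_product_left[OF scalar_product[OF that]])
  have "((\<lambda>y. w y $ i) has_derivative (\<lambda>h. w' h $ i)) (at x)" for i
    by (rule bounded_linear.has_derivative[OF bounded_linear_vec_nth w])
  then have "((\<lambda>y. \<Sum>i\<in>UNIV. w y $ i * G y (axis i 1) z) has_derivative
      (\<lambda>h. \<Sum>i\<in>UNIV. w x $ i * dG x (axis i 1) z h + w' h $ i * G x (axis i 1) z)) (at x)"
    by (intro has_derivative_sum has_derivative_mult G_has_derivative assms)
  moreover have "(\<Sum>i\<in>UNIV. w x $ i * dG x (axis i 1) z h + w' h $ i * G x (axis i 1) z)
      = dG x (w x) z h + G x (w' h) z" for h
  proof -
    have "linear (\<lambda>w. dG x w z h)"
      using assms by (intro linearI) (simp_all add: dG_add_left dG_scale_left)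
    then show ?thesis
      using linear_axis_expansion[of "\<lambda>u. dG x u z h" "w x"]
        linear_axis_expansion[OF lin[OF assms(1)], of "w' h"]
      by (simp add: sum.distrib)
  qed
  ultimately have "((\<lambda>y. \<Sum>i\<in>UNIV. w y $ i * G y (axis i 1) z) has_derivative
      (\<lambda>h. dG x (w x) z h + G x (w' h) z)) (at x)"
    by simp
  then show ?thesis
  proof (rule has_derivative_transform_within_open[OF _ open_domain assms(1)])
    fix y assume "y \<in> \<Omega>"
    show "(\<Sum>i\<in>UNIV. w y $ i * G y (axis i 1) z) = G y (w y) z"
      by (rule linear_axis_expansion[OF lin[OF \<open>y \<in> \<Omega>\<close>], symmetric])
  qed
qed

text \<open>The classical coordinate formula \<open>\<partial>\<Gamma> - \<partial>\<Gamma> + \<Gamma>\<Gamma> - \<Gamma>\<Gamma>\<close> for the curvature. It agrees with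
  \<open>local_curvature\<close> because brackets and component derivatives of constant fields vanish.\<close>

definition Riem :: "real ^ 'n \<Rightarrow> real ^ 'n \<Rightarrow> real ^ 'n \<Rightarrow> real ^ 'n \<Rightarrow> real ^ 'n" where
  "Riem x X Y Z = d\<Gamma> x Y Z X - d\<Gamma> x X Z Y + \<Gamma> x X (\<Gamma> x Y Z) - \<Gamma> x Y (\<Gamma> x X Z)"

lemma local_curvature_eq_Riem:
  assumes "x \<in> \<Omega>"
  shows "local_curvature G (\<lambda>_. X) (\<lambda>_. Y) (\<lambda>_. Z) x = Riem x X Y Z"
proof -
  have "cov_deriv G (\<lambda>_. U) (\<lambda>_. V) = (\<lambda>y. \<Gamma> y U V)" for U V
    by (simp add: cov_deriv_def fun_eq_iff)
  moreover have "lie_bracket (\<lambda>_. X) (\<lambda>_. Y) = (\<lambda>_. 0)"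
    by (simp add: lie_bracket_def fun_eq_iff)
  moreover have "\<Gamma> x 0 Z = 0"
    using \<Gamma>_scale_left[OF assms, of 0 0 Z] by simp
  ultimately show ?thesis
    by (simp add: local_curvature_def Riem_def cov_deriv_def d\<Gamma>_def)
qed

lemma Riem_linear: "x \<in> \<Omega> \<Longrightarrow> linear (\<lambda>Y. Riem x X Y Z)"
  by (auto intro!: linearI simp: Riem_def \<Gamma>_add_left \<Gamma>_add_right \<Gamma>_scale_left \<Gamma>_scale_right
     d\<Gamma>_add_left d\<Gamma>_add_right d\<Gamma>_scale_left d\<Gamma>_scale_right
     linear_add[OF d\<Gamma>_linear] linear_scale[OF d\<Gamma>_linear] algebra_simps)

text \<open>The first Bianchi identity \<open>R(X,Y)Z + R(Y,Z)X + R(Z,X)Y = 0\<close>, a consequence of the symmetry of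
  \<open>\<Gamma>\<close>, in the form in which it is contracted below.\<close>

lemma Riem_bianchi:
  "x \<in> \<Omega> \<Longrightarrow> Riem x X Y Z - Riem x X Z Y = - Riem x Y Z X"
  using d\<Gamma>_sym[of x Y Z X] d\<Gamma>_sym[of x X Z Y] d\<Gamma>_sym[of x X Y Z]
  by (simp add: Riem_def \<Gamma>_sym[of x Y Z] \<Gamma>_sym[of x X Z] \<Gamma>_sym[of x X Y])

text \<open>Differentiate \<open>Y g(Z,W) = g(\<nabla>\<^sub>Y Z, W) + g(Z, \<nabla>\<^sub>Y W)\<close> in the direction \<open>X\<close> and antisymmetrize in
  \<open>X\<close> and \<open>Y\<close>. The left-hand side vanishes, the mixed terms \<open>g(\<nabla>\<^sub>Y Z, \<nabla>\<^sub>X W)\<close> cancel, and the rest is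
  \<open>g(R(X,Y)Z, W) + g(Z, R(X,Y)W)\<close>.\<close>

lemma Riem_skew:
  assumes "x \<in> \<Omega>"
  shows "G x (Riem x X Y Z) W = - G x Z (Riem x X Y W)"
proof -
  have second: "frechet_derivative (\<lambda>y. dG y Z W V) (at x) U =
     G x (\<Gamma> x U (\<Gamma> x V Z)) W + G x (\<Gamma> x U W) (\<Gamma> x V Z) + G x (d\<Gamma> x V Z U) W
   + (G x (\<Gamma> x U (\<Gamma> x V W)) Z + G x (\<Gamma> x U Z) (\<Gamma> x V W) + G x (d\<Gamma> x V W U) Z)" for U V
  proof -
    have "((\<lambda>y. G y (\<Gamma> y V Z) W + G y (\<Gamma> y V W) Z) has_derivative
        (\<lambda>h. (dG x (\<Gamma> x V Z) W h + G x (d\<Gamma> x V Z h) W) +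
             (dG x (\<Gamma> x V W) Z h + G x (d\<Gamma> x V W h) Z))) (at x)"
      by (intro has_derivative_add G_along_field_has_derivative \<Gamma>_has_derivative assms)
    then have "((\<lambda>y. dG y Z W V) has_derivative
        (\<lambda>h. (dG x (\<Gamma> x V Z) W h + G x (d\<Gamma> x V Z h) W) +
             (dG x (\<Gamma> x V W) Z h + G x (d\<Gamma> x V W h) Z))) (at x)"
      by (rule has_derivative_transform_within_open[OF _ open_domain assms]) (simp add: metric_compatible)
    from frechet_derivative_at[OF this, symmetric] show ?thesis
      by (simp add: metric_compatible assms)
  qed
  have "frechet_derivative (\<lambda>y. dG y Z W Y) (at x) X = frechet_derivative (\<lambda>y. dG y Z W X) (at x) Y"
    unfolding dG_def by (rule symmetric_directional_derivatives[OF open_domain assms smooth])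
  moreover have lower: "G x (Riem x X Y Z) W = G x (d\<Gamma> x Y Z X) W - G x (d\<Gamma> x X Z Y) W
      + G x (\<Gamma> x X (\<Gamma> x Y Z)) W - G x (\<Gamma> x Y (\<Gamma> x X Z)) W" for Z W
    using assms by (simp add: Riem_def G_simps)
  ultimately have "G x (Riem x X Y Z) W + G x (Riem x X Y W) Z = 0"
    using G_sym[OF assms, of "\<Gamma> x X W" "\<Gamma> x Y Z"] G_sym[OF assms, of "\<Gamma> x X Z" "\<Gamma> x Y W"]
      lower[of Z W] lower[of W Z]
    unfolding second by linarith
  then show ?thesis
    using G_sym[OF assms, of "Riem x X Y W" Z] by linarith
qed

end

section \<open>Algebra in a tangent space\<close>

text \<open>The pointwise part of the argument, for one tangent space: \<open>x\<close> is the value of \<open>\<xi>\<close>, and the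
  hypotheses on the curvature are the only differential geometry that is needed.\<close>

locale nullity_point =
  fixes g :: "('m, 'n::finite) form_field" and c :: "('m, 'n) chart" and p :: 'm
    and x :: "real ^ 'n" and k \<epsilon> :: real
  assumes metric: "scalar_product (g c p)"
    and curvature_linear: "linear (\<lambda>Y. curvature g c p X Y Z)"
    and bianchi: "curvature g c p X Y Z - curvature g c p X Z Y = - curvature g c p Y Z X"
    and curvature_skew: "g c p (curvature g c p X Y Z) W = - g c p Z (curvature g c p X Y W)"
    and unit: "g c p x x = \<epsilon>" "\<epsilon> \<in> {1, -1}"
    and nullity: "curvature g c p X Y x = k *\<^sub>R (g c p Y x *\<^sub>R X - g c p X x *\<^sub>R Y)"
begin

abbreviation "gp \<equiv> g c p"
abbreviation "R \<equiv> curvature g c p"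
abbreviation "S \<equiv> ricci g c p"
abbreviation "Q \<equiv> ricci_operator g c p"
abbreviation "scal \<equiv> scalar_curvature g c p"

lemmas g_bilinear = scalar_product_bilinear[OF metric]
lemmas g_sym = scalar_product_sym[OF metric]

lemma g_linear: "linear (\<lambda>X. gp X Y)" "linear (gp X)"
  by (simp_all add: linear_scalar_product_left[OF metric] linear_scalar_product_right[OF metric])

lemma ricci_linear_left: "linear (\<lambda>Y. S Y Z)"
  unfolding ricci_def
  by (intro linearI) (simp_all add: linear_add[OF curvature_linear] linear_scale[OF curvature_linear]
      lin_trace_add lin_trace_scale)

text \<open>By the Bianchi identity \<open>S(Y,Z) - S(Z,Y)\<close> is minus the trace of \<open>R(Y,Z)\<close>, which is skew.\<close>

lemma ricci_sym: "S Y Z = S Z Y"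
proof -
  have "S Y Z - S Z Y = lin_trace (\<lambda>X. R X Y Z - R X Z Y)"
    by (simp add: ricci_def lin_trace_diff)
  also have "\<dots> = - lin_trace (R Y Z)"
    by (simp add: bianchi lin_trace_minus)
  also have "lin_trace (R Y Z) = 0"
    using lin_trace_skew[OF metric] curvature_skew by blast
  finally show ?thesis by simp
qed

lemma ricci_linear_right: "linear (S Y)"
  using ricci_linear_left[of Y] by (simp add: ricci_sym[of _ Y])

lemma g_ricci_operator: "gp (Q X) Y = S X Y"
  using theI'[OF scalar_product_represents[OF metric ricci_linear_right]]
  unfolding ricci_operator_def by blast

lemma ricci_unit: "S Y x = k * (real CARD('n) - 1) * gp Y x"
  unfolding ricci_def nullity lin_trace_scale lin_trace_diff lin_trace_ident
    lin_trace_rank_one[OF g_linear(1)]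
  by (simp add: algebra_simps)

text \<open>The terms with coefficients \<open>b 2\<close>, \<open>b 3\<close>, \<open>b 5\<close>, \<open>b 6\<close> are maps of rank one in \<open>X\<close>; each of them has trace
  \<open>S(Y,Z)\<close>, by symmetry of \<open>S\<close> and the definition of \<open>Q\<close>.\<close>

lemma T_ricci_eq:
  "T_ricci b g c p Y Z = (b 0 + real CARD('n) * b 1 + b 2 + b 3 + b 5 + b 6) * S Y Z
     + (b 4 * scal + (real CARD('n) - 1) * b 7 * scal) * gp Y Z"
proof -
  have lin: "linear (\<lambda>X. a * f X)" if "linear f" for a :: real and f :: "real ^ 'n \<Rightarrow> real"
    using linear_compose_scale_right[OF that, of a] by simp
  have "lin_trace Q = scal" "lin_trace (\<lambda>X. R X Y Z) = S Y Z"
    by (simp_all add: scalar_curvature_def ricci_def)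
  then show ?thesis
    unfolding T_ricci_def T_curvature_def
    by (simp add: lin_trace_add lin_trace_diff lin_trace_scale lin_trace_ident
        lin_trace_rank_one lin g_linear ricci_linear_left g_ricci_operator
        ricci_sym[of Z Y] g_sym[of Y "Q Z"] algebra_simps)
qed

text \<open>Skewness moves \<open>R(\<xi>,Y)\<close> to \<open>\<xi>\<close>, where the nullity condition gives its value.\<close>

lemma g_curvature_unit: "gp (R x Y U) x = k * (\<epsilon> * gp Y U - gp Y x * gp U x)"
  unfolding curvature_skew[of x Y U x] nullity
  by (simp add: bilinear_rsub[OF g_bilinear] bilinear_rmul[OF g_bilinear] unit
     g_sym[of U Y] algebra_simps)

lemma T_curvature_unit_component:
  fixes a :: "nat \<Rightarrow> real"
  defines "\<kappa> \<equiv> k * (real CARD('n) - 1)"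
  shows "gp (T_curvature a g c p x Y U) x =
     a 0 * k * (\<epsilon> * gp Y U - gp Y x * gp U x) + a 1 * \<epsilon> * S Y U + a 4 * \<kappa> * \<epsilon> * gp Y U
   + (a 2 + a 3 + a 5 + a 6) * \<kappa> * gp Y x * gp U x
   + a 7 * scal * (\<epsilon> * gp Y U - gp Y x * gp U x)"
  unfolding T_curvature_def
  by (simp add: bilinear_ladd[OF g_bilinear] bilinear_lsub[OF g_bilinear] bilinear_lmul[OF g_bilinear]
      g_curvature_unit g_ricci_operator ricci_unit ricci_sym[of x U] ricci_sym[of x Y] g_sym[of x Y] g_sym[of x U]
      unit(1) \<kappa>_def algebra_simps)

lemma ricci_operator_unit: "Q x = (k * (real CARD('n) - 1)) *\<^sub>R x"
  by (rule scalar_product_eqI[OF metric])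
     (simp add: g_ricci_operator ricci_sym[of x] ricci_unit bilinear_lmul[OF g_bilinear] g_sym[of x])

lemma T_curvature_unit_unit:
  fixes a :: "nat \<Rightarrow> real"
  defines "\<kappa> \<equiv> k * (real CARD('n) - 1)"
  shows "T_curvature a g c p x Y x =
     ((a 0 * k + (a 1 + a 3 + a 4 + a 6) * \<kappa> + a 7 * scal) * gp Y x) *\<^sub>R x
   + (\<epsilon> * (a 2 * \<kappa> - a 0 * k - a 7 * scal)) *\<^sub>R Y + (a 5 * \<epsilon>) *\<^sub>R Q Y"
  unfolding T_curvature_def nullity ricci_operator_unit
  by (simp add: ricci_unit ricci_sym[of x Y] g_sym[of x Y] unit(1) \<kappa>_def algebra_simps)

text \<open>Both sides of the hypothesis are evaluated as described at the beginning; the result differs from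
  the conclusion by a rearrangement only. The term with \<open>gp Y x * gp U x\<close> collects the products
  \<open>\<eta>(Y)\<eta>(U)\<close>; in it \<open>a 3\<close> and \<open>a 6\<close> occur in both halves of the derivation, hence their factor \<open>2\<close>,
  and the contributions of \<open>a 0\<close> and \<open>a 7\<close> cancel.\<close>

lemma pointwise_identity:
  fixes a b :: "nat \<Rightarrow> real" and L :: real
  assumes pseudosym: "act (T_curvature a g c p x Y) (T_ricci b g c p) U x
     = L * act (wedge gp x Y) (T_ricci b g c p) U x"
  defines "\<kappa> \<equiv> k * (real CARD('n) - 1)"
    and "B \<equiv> b 0 + real CARD('n) * b 1 + b 2 + b 3 + b 5 + b 6"
    and "D \<equiv> b 4 * scal + (real CARD('n) - 1) * b 7 * scal"
  shows "\<epsilon> * a 5 * B * ricci_square g c p Y U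
    + (\<epsilon> * B * (- k * a 0 + \<kappa> * a 1 + \<kappa> * a 2 - a 7 * scal) + \<epsilon> * (a 1 + a 5) * D) * S Y U
    + (\<epsilon> * \<kappa> * (a 2 + a 4) * D + \<epsilon> * \<kappa> * B * (k * a 0 + \<kappa> * a 4 + a 7 * scal)) * gp Y U
    + \<kappa> * (a 1 + a 2 + 2 * a 3 + a 4 + a 5 + 2 * a 6) * (D + \<kappa> * B) * gp Y x * gp U x
    = L * B * (\<epsilon> * \<kappa> * gp Y U - \<epsilon> * S Y U)"
proof -
  define K where "K = T_ricci b g c p"
  have K: "K X Z = B * S X Z + D * gp X Z" for X Z
    by (simp add: K_def T_ricci_eq B_def D_def)
  have K_sym: "K X Z = K Z X" for X Z
    using ricci_sym[of X Z] g_sym[of X Z] by (simp add: K)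
  have Kx: "K Z x = (B * \<kappa> + D) * gp Z x" for Z
    by (simp add: K ricci_unit \<kappa>_def algebra_simps)
  have K_linear: "linear (K U)"
    using linear_compose_add[OF linear_compose_scale_right[OF ricci_linear_right[of U], of B]
        linear_compose_scale_right[OF g_linear(2)[of U], of D]]
    by (simp add: K[abs_def])
  have KQ: "K U (Q Z) = B * ricci_square g c p Z U + D * S Z U" for Z
    using ricci_sym[of U "Q Z"] g_sym[of U "Q Z"] g_ricci_operator[of Z U]
    by (simp add: K ricci_square_def)
  have "K (T_curvature a g c p x Y U) x + K U (T_curvature a g c p x Y x)
     = L * (K (wedge gp x Y U) x + K U (wedge gp x Y x))"
    using pseudosym by (simp add: act_def K_def algebra_simps)
  moreover have "K U (T_curvature a g c p x Y x) =
     (a 0 * k + (a 1 + a 3 + a 4 + a 6) * \<kappa> + a 7 * scal) * gp Y x * ((B * \<kappa> + D) * gp U x)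
   + \<epsilon> * (a 2 * \<kappa> - a 0 * k - a 7 * scal) * (B * S Y U + D * gp Y U)
   + a 5 * \<epsilon> * (B * ricci_square g c p Y U + D * S Y U)"
    unfolding T_curvature_unit_unit linear_add[OF K_linear] linear_scale[OF K_linear] real_scaleR_def
      Kx KQ K_sym[of U Y] K[of Y U] \<kappa>_def by (rule refl)
  moreover have "K (wedge gp x Y U) x = (B * \<kappa> + D) * (\<epsilon> * gp Y U - gp U x * gp Y x)"
    by (simp add: Kx wedge_def bilinear_lsub[OF g_bilinear] bilinear_lmul[OF g_bilinear]
        unit(1) g_sym[of x U])
  moreover have "K U (wedge gp x Y x) = gp Y x * ((B * \<kappa> + D) * gp U x) - \<epsilon> * (B * S Y U + D * gp Y U)"
    by (simp add: wedge_def linear_diff[OF K_linear] linear_scale[OF K_linear] Kx unit(1)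
        K_sym[of U Y] K[of Y U])
  ultimately show ?thesis
    unfolding Kx T_curvature_unit_component \<kappa>_def[symmetric] by algebra
qed

end

section \<open>The identity on the manifold\<close>

text \<open>A chart carries the metric to an open subset of \<open>real ^ 'n\<close>, where the curvature identities
  are available.\<close>

lemma nullity_point_chart:
  assumes "Nk_semi_riemannian A g \<xi> k \<epsilon>" "c \<in> A" "p \<in> chart_dom c"
  shows "nullity_point g c p (\<xi> c p) k \<epsilon>"
proof -
  have chart: "is_chart c" and metric: "semi_riemannian_metric A g"
    using assms(1,2) by (auto simp: Nk_semi_riemannian_def smooth_atlas_def)
  have hom: "homeomorphism (chart_dom c) (chart_image c) (coord c) (coord_inv c)"
    and op: "open (chart_image c)"
    using chart by (simp_all add: is_chart_def)
  have scalar: "scalar_product (g c q)" if "q \<in> chart_dom c" for q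
    using metric assms(2) that by (simp add: semi_riemannian_metric_def)
  have "coord_inv c y \<in> chart_dom c" if "y \<in> chart_image c" for y
    using homeomorphism_image2[OF hom] that by blast
  then interpret local_metric "chart_image c" "\<lambda>y. g c (coord_inv c y)"
    using metric assms(2)
    by unfold_locales (auto simp: op scalar semi_riemannian_metric_def)
  have inside: "coord c p \<in> chart_image c"
    using assms(3) by (simp add: chart_image_def)
  have inv: "coord_inv c (coord c p) = p"
    by (rule homeomorphism_apply1[OF hom assms(3)])
  have curv: "curvature g c p X Y Z = Riem (coord c p) X Y Z" for X Y Z
    by (simp add: curvature_def local_curvature_eq_Riem[OF inside])
  show ?thesis
  proof (rule nullity_point.intro)
    show "scalar_product (g c p)"
      by (rule scalar[OF assms(3)])
    show "linear (\<lambda>Y. curvature g c p X Y Z)" for X Z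
      unfolding curv by (rule Riem_linear[OF inside])
    show "curvature g c p X Y Z - curvature g c p X Z Y = - curvature g c p Y Z X" for X Y Z
      unfolding curv by (rule Riem_bianchi[OF inside])
    show "g c p (curvature g c p X Y Z) W = - g c p Z (curvature g c p X Y W)" for X Y Z W
      using Riem_skew[OF inside, of X Y Z W] unfolding curv inv .
    show "g c p (\<xi> c p) (\<xi> c p) = \<epsilon>" "\<epsilon> \<in> {1, -1}"
      "curvature g c p X Y (\<xi> c p) = k *\<^sub>R (g c p Y (\<xi> c p) *\<^sub>R X - g c p X (\<xi> c p) *\<^sub>R Y)" for X Y
      using assms by (simp_all add: Nk_semi_riemannian_def)
  qed
qed

lemma pseudosymmetric_identity_at:
  fixes A :: "('m::{t2_space, second_countable_topology}, 'n::finite) chart set"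
    and g :: "('m, 'n) form_field" and a b :: "nat \<Rightarrow> real"
  assumes Nk: "Nk_semi_riemannian A g \<xi> k \<epsilon>"
    and pseudosym: "pseudosymmetric A g a b L"
    and c: "c \<in> A" and p: "p \<in> chart_dom c"
  shows "let n = real CARD('n); r = scalar_curvature g c p in
      \<epsilon> * a 5 * (b 0 + n * b 1 + b 2 + b 3 + b 5 + b 6) * ricci_square g c p Y U
      + (\<epsilon> * (b 0 + n * b 1 + b 2 + b 3 + b 5 + b 6) * (- k * a 0 + k * (n - 1) * a 1 + k * (n - 1) * a 2 - a 7 * r)
         + \<epsilon> * (a 1 + a 5) * (b 4 * r + (n - 1) * b 7 * r)) * ricci g c p Y U
      + (\<epsilon> * k * (n - 1) * (a 2 + a 4) * (b 4 * r + (n - 1) * b 7 * r)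
         + \<epsilon> * k * (n - 1) * (b 0 + n * b 1 + b 2 + b 3 + b 5 + b 6) * (k * a 0 + k * (n - 1) * a 4 + a 7 * r))
          * g c p Y U
      + k * (n - 1) * (a 1 + a 2 + 2 * a 3 + a 4 + a 5 + 2 * a 6)
          * ((b 4 * r + (n - 1) * b 7 * r) + k * (n - 1) * (b 0 + n * b 1 + b 2 + b 3 + b 5 + b 6))
          * eta_form g \<xi> \<epsilon> c p Y * eta_form g \<xi> \<epsilon> c p U
      = L p * (b 0 + n * b 1 + b 2 + b 3 + b 5 + b 6)
          * (\<epsilon> * k * (n - 1) * g c p Y U - \<epsilon> * ricci g c p Y U)"
proof -
  interpret nullity_point g c p "\<xi> c p" k \<epsilon>
    by (rule nullity_point_chart[OF Nk c p])
  have "\<epsilon> * \<epsilon> = 1"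
    using unit(2) by auto
  \<comment> \<open>the sign in the definition of \<open>\<eta>\<close> drops out of \<open>\<eta>(Y)\<eta>(U)\<close>\<close>
  then have eta: "t * eta_form g \<xi> \<epsilon> c p Y * eta_form g \<xi> \<epsilon> c p U
      = t * g c p Y (\<xi> c p) * g c p U (\<xi> c p)" for t
    unfolding eta_form_def by algebra
  have "act (T_curvature a g c p (\<xi> c p) Y) (T_ricci b g c p) U (\<xi> c p)
     = L p * act (wedge (g c p) (\<xi> c p) Y) (T_ricci b g c p) U (\<xi> c p)"
    using pseudosym c p by (simp add: pseudosymmetric_def)
  from pointwise_identity[OF this] show ?thesis
    unfolding Let_def eta by (simp only: mult.assoc)
qed

theorem theorem6p3:
  fixes A :: "('m::{t2_space, second_countable_topology}, 'n::finite) chart set"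
    and g :: "('m, 'n) form_field"
    and \<xi> :: "('m, 'n) vfield"
    and k \<epsilon> :: real
    and a b :: "nat \<Rightarrow> real"
  assumes "Nk_semi_riemannian A g \<xi> k \<epsilon>"
  shows "(\<forall>L. pseudosymmetric A g a b L \<longrightarrow>
        (\<forall>Y U. vector_field A Y \<longrightarrow> vector_field A U \<longrightarrow>
        (\<forall>c\<in>A. \<forall>p\<in>chart_dom c.
          let n = real CARD('n); r = scalar_curvature g c p in
            \<epsilon> * a 5 * (b 0 + n * b 1 + b 2 + b 3 + b 5 + b 6) * ricci_square g c p (Y c p) (U c p)
            + (\<epsilon> * (b 0 + n * b 1 + b 2 + b 3 + b 5 + b 6) * (- k * a 0 + k * (n - 1) * a 1 + k * (n - 1) * a 2 - a 7 * r)
               + \<epsilon> * (a 1 + a 5) * (b 4 * r + (n - 1) * b 7 * r)) * ricci g c p (Y c p) (U c p)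
            + (\<epsilon> * k * (n - 1) * (a 2 + a 4) * (b 4 * r + (n - 1) * b 7 * r)
               + \<epsilon> * k * (n - 1) * (b 0 + n * b 1 + b 2 + b 3 + b 5 + b 6) * (k * a 0 + k * (n - 1) * a 4 + a 7 * r))
                * g c p (Y c p) (U c p)
            + k * (n - 1) * (a 1 + a 2 + 2 * a 3 + a 4 + a 5 + 2 * a 6)
                * ((b 4 * r + (n - 1) * b 7 * r) + k * (n - 1) * (b 0 + n * b 1 + b 2 + b 3 + b 5 + b 6))
                * eta_form g \<xi> \<epsilon> c p (Y c p) * eta_form g \<xi> \<epsilon> c p (U c p)
            = L p * (b 0 + n * b 1 + b 2 + b 3 + b 5 + b 6)
                * (\<epsilon> * k * (n - 1) * g c p (Y c p) (U c p) - \<epsilon> * ricci g c p (Y c p) (U c p)))))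
    \<and> (\<forall>L. pseudosymmetric A g a a L \<longrightarrow>
        (\<forall>Y U. vector_field A Y \<longrightarrow> vector_field A U \<longrightarrow>
        (\<forall>c\<in>A. \<forall>p\<in>chart_dom c.
          let n = real CARD('n); r = scalar_curvature g c p in
            \<epsilon> * a 5 * (a 0 + n * a 1 + a 2 + a 3 + a 5 + a 6) * ricci_square g c p (Y c p) (U c p)
            + (\<epsilon> * (a 0 + n * a 1 + a 2 + a 3 + a 5 + a 6) * (- k * a 0 + k * (n - 1) * a 1 + k * (n - 1) * a 2 - a 7 * r)
               + \<epsilon> * (a 1 + a 5) * (a 4 * r + (n - 1) * a 7 * r)) * ricci g c p (Y c p) (U c p)
            + (\<epsilon> * k * (n - 1) * (a 2 + a 4) * (a 4 * r + (n - 1) * a 7 * r)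
               + \<epsilon> * k * (n - 1) * (a 0 + n * a 1 + a 2 + a 3 + a 5 + a 6) * (k * a 0 + k * (n - 1) * a 4 + a 7 * r))
                * g c p (Y c p) (U c p)
            + k * (n - 1) * (a 1 + a 2 + 2 * a 3 + a 4 + a 5 + 2 * a 6)
                * ((a 4 * r + (n - 1) * a 7 * r) + k * (n - 1) * (a 0 + n * a 1 + a 2 + a 3 + a 5 + a 6))
                * eta_form g \<xi> \<epsilon> c p (Y c p) * eta_form g \<xi> \<epsilon> c p (U c p)
            = L p * (a 0 + n * a 1 + a 2 + a 3 + a 5 + a 6)
                * (\<epsilon> * k * (n - 1) * g c p (Y c p) (U c p) - \<epsilon> * ricci g c p (Y c p) (U c p)))))"
  using pseudosymmetric_identity_at[OF assms] by (simp only: Let_def) blast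

end
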